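(* Let $A\in\mathbb{R}$, $A\neq 0$. (i) For the initial conditions $x(0)=A$, $\dot x(0)=0$, the differential equation $x\ddot x+1=0$ has a weak $\mathcal{C}^0$-periodic solution with period $T(A)=2\sqrt{2\pi}\,|A|$. (ii) For $k\in\mathbb{R}$, $k\neq 0$, let $T(A;k)$ be the period of the periodic orbit of the planar system $$\dot x=y,\qquad \dot y=-\frac{x}{x^2+k^2}$$ with initial conditions $x(0)=A$, $y(0)=0$. Then $$T(A;k)=4|A|\int_0^1\frac{ds}{\sqrt{\ln\left(\frac{A^2+k^2}{A^2s^2+k^2}\right)}}$$ and $$\lim_{k\to 0}T(A;k)=4|A|\int_0^1\frac{1}{\sqrt{-2\ln s}}\,ds=2\sqrt{2\pi}\,|A|=T(A).$$
   Context: A weak $\mathcal{C}^0$-periodic solution of $x\ddot x+1=0$ is a continuous periodic function $x:\mathbb{R}\to\mathbb{R}$ that satisfies the differential equation (in particular is twice differentiable) on an open and dense subset of $\mathbb{R}$, being merely of class $\mathcal{C}^0$ at some isolated points (the complement of the open dense set). It has the initial conditions $x(0)=A$, $\dot x(0)=0$ if it is differentiable at $0$ with these values. For $k\neq0$ the planar system in (ii) has a global center at the origin, that is, every non-constant orbit is periodic; $T(A;k)$ is the (minimal positive) period of the orbit through $(A,0)$. *)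

theory Defs
  imports "HOL-Analysis.Analysis" "HOL-Library.Periodic_Fun"
begin

text \<open>The period of a function is its least positive period.\<close>

definition has_minimal_period :: "(real \<Rightarrow> 'a) \<Rightarrow> real \<Rightarrow> bool" where
  "has_minimal_period f T \<longleftrightarrow>
     0 < T \<and> periodic_fun_simple f T \<and> (\<forall>S>0. periodic_fun_simple f S \<longrightarrow> T \<le> S)"

definition of_class_C1_at :: "(real \<Rightarrow> real) \<Rightarrow> real \<Rightarrow> bool" where
  "of_class_C1_at x t \<longleftrightarrow> (\<exists>V. open V \<and> t \<in> V \<and> x C1_differentiable_on V)"

text \<open>
  Since \<open>U\<close> is open, \<^term>\<open>deriv x\<close> is the derivative of \<open>x\<close> on a whole neighbourhood
  of each \<open>t \<in> U\<close>, so the second derivative below is the usual one.  The last conjunct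
  says that \<open>x\<close> is merely of class C0 at the points outside \<open>U\<close>.
\<close>

definition weak_C0_periodic_solution :: "(real \<Rightarrow> real) \<Rightarrow> bool" where
  "weak_C0_periodic_solution x \<longleftrightarrow>
     continuous_on UNIV x \<and>
     (\<exists>T>0. periodic_fun_simple x T) \<and>
     (\<exists>U. open U \<and> closure U = UNIV \<and> discrete (- U) \<and>
        (\<forall>t\<in>U. x differentiable at t \<and> deriv x differentiable at t \<and>
               x t * deriv (deriv x) t + 1 = 0) \<and>
        (\<forall>t. t \<notin> U \<longrightarrow> \<not> of_class_C1_at x t))"

definition planar_field :: "real \<Rightarrow> real \<times> real \<Rightarrow> real \<times> real" where
  "planar_field k = (\<lambda>(x, y). (y, - x / (x\<^sup>2 + k\<^sup>2)))"

definition planar_solution :: "real \<Rightarrow> real \<Rightarrow> (real \<Rightarrow> real \<times> real) \<Rightarrow> bool" where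
  "planar_solution k A \<gamma> \<longleftrightarrow>
     \<gamma> 0 = (A, 0) \<and> (\<forall>t. (\<gamma> has_vector_derivative planar_field k (\<gamma> t)) (at t))"

text \<open>Only meaningful for \<open>k \<noteq> 0\<close> and \<open>A \<noteq> 0\<close>.\<close>

definition orbit_period :: "real \<Rightarrow> real \<Rightarrow> real" where
  "orbit_period A k = (THE T. \<exists>\<gamma>. planar_solution k A \<gamma> \<and> has_minimal_period \<gamma> T)"

text \<open>
  At the endpoints (\<open>s = 1\<close>, and also \<open>s = 0\<close> for the second function) the totalised
  operations give these integrands arbitrary finite values, which do not affect the integrals.
\<close>

definition period_integrand :: "real \<Rightarrow> real \<Rightarrow> real \<Rightarrow> real" where
  "period_integrand A k s = 1 / sqrt (ln ((A\<^sup>2 + k\<^sup>2) / (A\<^sup>2 * s\<^sup>2 + k\<^sup>2)))"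

definition limit_integrand :: "real \<Rightarrow> real" where
  "limit_integrand s = 1 / sqrt (- 2 * ln s)"

end

theory Submission
  imports Defs "HOL-Probability.Distributions"
begin

text \<open>
  Both equations are one family: with \<open>k = 0\<close>, the planar system is \<open>x x'' + 1 = 0\<close>.  Along its solutions
  \<open>y\<^sup>2 + ln (x\<^sup>2 + k\<^sup>2)\<close> is constant, so the orbit through \<open>(A, 0)\<close> oscillates between \<open>x = A\<close> and
  \<open>x = - A\<close> and can be written \<open>x = A cos \<theta>\<close> with an increasing phase \<open>\<theta>\<close>.  Energy conservation then forces
  \<open>dt/d\<theta> = w(\<theta>)\<close>, where
  \<open>w(\<theta>)\<^sup>2 = A\<^sup>2 sin\<^sup>2 \<theta> / ln ((A\<^sup>2 + k\<^sup>2) / (A\<^sup>2 cos\<^sup>2 \<theta> + k\<^sup>2))\<close>.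
  The main point is that \<open>w\<close> (\<open>slowness\<close>) extends to a continuous nonnegative function of \<open>k\<close>
  and \<open>\<theta>\<close>, also at \<open>k = 0\<close>: up to the factor \<open>A\<^sup>2 + k\<^sup>2\<close>, its square is the logarithmic mean
  of \<open>1\<close> and a number in \<open>[0, 1]\<close>.  It vanishes only at the collisions with the origin, that is,
  for \<open>k = 0\<close> and \<open>cos \<theta> = 0\<close>.  Its antiderivative (\<open>clock\<close>) is therefore
  an increasing homeomorphism of the line, and the inverse of that (\<open>phase\<close>) yields a motion for all times.

  This motion satisfies the equations at all times other than collisions (\<open>DERIV_position\<close>,
  \<open>DERIV_velocity\<close>).  For \<open>k \<noteq> 0\<close> there are no collisions and it is the unique solution of the planar system; for
  \<open>k = 0\<close> it is the weak solution, which is not differentiable at a collision because \<open>w\<close> vanishes there.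
  Its minimal period is the time of a phase increment \<open>2\<pi>\<close>, that is, four times the integral of \<open>w\<close> over
  \<open>[0, \<pi>/2]\<close>.  The substitution \<open>s = cos \<theta>\<close> gives the stated integral (\<open>has_integral_period_integrand\<close>), and
  continuity of \<open>w\<close> in \<open>k\<close> gives the limit (\<open>tendsto_orbit_period\<close>).  Its value comes from
  the Gaussian integral by \<open>s = exp (- v\<^sup>2)\<close> (\<open>has_integral_limit_integrand\<close>).
\<close>

section \<open>Time per unit of phase\<close>

text \<open>
  The logarithmic mean of \<open>r\<close> and \<open>1\<close>.  At \<open>r = 0\<close> the totalised \<open>ln\<close> and division give the
  value \<open>0\<close>, which is also the limit from the right.
\<close>

definition log_mean :: "real \<Rightarrow> real" where
  "log_mean r = (if r = 1 then 1 else (r - 1) / ln r)"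

lemma log_mean_0 [simp]: "log_mean 0 = 0"
  by (simp add: log_mean_def)

lemma log_mean_pos: "0 < log_mean r" if "0 < r"
  using that by (cases "r < 1") (auto simp: log_mean_def divide_neg_neg)

lemma log_mean_mult_ln: "log_mean r * ln r = r - 1" if "0 < r"
  using that by (auto simp: log_mean_def)

text \<open>
  Near \<open>1\<close> the quotient is the reciprocal of a difference quotient of \<open>ln\<close>; near \<open>0\<close> it tends to \<open>0\<close>
  because \<open>ln\<close> diverges.  On an orbit, \<open>r = 1\<close> is a turning point and
  \<open>r = 0\<close>, possible only for \<open>k = 0\<close>, is a collision with the origin.
\<close>

lemma continuous_on_log_mean: "continuous_on {0..} log_mean"
proof (rule continuous_on_eq_continuous_within[THEN iffD2], rule ballI)
  fix r :: real assume "r \<in> {0..}"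
  then consider "r = 0" | "r = 1" | "0 < r" "r \<noteq> 1" by fastforce
  then show "continuous (at r within {0..}) log_mean"
  proof cases
    case 1
    have "((\<lambda>r. (r - 1) / ln r) \<longlongrightarrow> 0) (at_right (0::real))"
      by (intro tendsto_divide_0 [where c = "0 - 1"] tendsto_intros
          filterlim_mono [OF ln_at_0 at_bot_le_at_infinity order.refl])
    moreover have "\<forall>\<^sub>F r in at_right 0. (r - 1) / ln r = log_mean r"
      by (auto simp: log_mean_def eventually_at_right_field intro!: exI[of _ 1])
    ultimately have "(log_mean \<longlongrightarrow> 0) (at_right 0)"
      by (rule Lim_transform_eventually)
    then show ?thesis
      using 1 by (simp add: continuous_within at_within_Ici_at_right)
  next
    case 2
    have "((\<lambda>r. (ln r - ln 1) / (r - 1)) \<longlongrightarrow> 1) (at (1::real))"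
      using DERIV_ln[of 1] by (simp add: has_field_derivative_iff)
    then have "((\<lambda>r. inverse ((ln r - ln 1) / (r - 1))) \<longlongrightarrow> inverse 1) (at (1::real))"
      by (rule tendsto_inverse) simp
    moreover have "\<forall>\<^sub>F r in at 1. inverse ((ln r - ln 1) / (r - 1)) = log_mean r"
      by (auto simp: log_mean_def eventually_at intro!: exI[of _ 1])
    ultimately have "(log_mean \<longlongrightarrow> 1) (at 1)"
      using Lim_transform_eventually by fastforce
    then have "isCont log_mean 1" by (simp add: isCont_def log_mean_def)
    then show ?thesis using 2 continuous_at_imp_continuous_at_within by blast
  next
    case 3
    have "isCont (\<lambda>r. (r - 1) / ln r) r"
      using 3 by (intro continuous_intros) auto
    moreover have "\<forall>\<^sub>F s in nhds r. (s - 1) / ln s = log_mean s"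
      using 3 t1_space_nhds[of r 1] by (auto simp: log_mean_def elim: eventually_mono)
    ultimately have "isCont log_mean r" using isCont_cong by fastforce
    then show ?thesis using continuous_at_imp_continuous_at_within by blast
  qed
qed

text \<open>
  The ratio of \<open>x\<^sup>2 + k\<^sup>2\<close> to its maximal value on the orbit, at \<open>x = A cos \<theta>\<close>.
\<close>

definition orbit_level :: "real \<Rightarrow> real \<Rightarrow> real \<Rightarrow> real" where
  "orbit_level A k \<theta> = (A\<^sup>2 * (cos \<theta>)\<^sup>2 + k\<^sup>2) / (A\<^sup>2 + k\<^sup>2)"

text \<open>
  The time \<open>dt/d\<theta>\<close> spent per unit of phase.  Since \<open>dx/dt = y\<close> and \<open>x = A cos \<theta>\<close>, it has to be
  \<open>- A sin \<theta> / y\<close> with \<open>y\<^sup>2 = - ln (orbit_level A k \<theta>)\<close> by conservation of energy, an expression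
  of the form \<open>0 / 0\<close> at every turning point.  As \<open>A\<^sup>2 sin\<^sup>2 \<theta>\<close> is \<open>A\<^sup>2 + k\<^sup>2\<close> times \<open>1 - orbit_level A k \<theta>\<close>,
  the square of this expression is \<open>A\<^sup>2 + k\<^sup>2\<close> times a logarithmic mean, which removes the singularity.
\<close>

definition slowness :: "real \<Rightarrow> real \<Rightarrow> real \<Rightarrow> real" where
  "slowness A k \<theta> = sqrt ((A\<^sup>2 + k\<^sup>2) * log_mean (orbit_level A k \<theta>))"

lemma energy_pos: "0 < A\<^sup>2 + k\<^sup>2" if "A \<noteq> 0" for A k :: real
  using that by (simp add: sum_power2_gt_zero_iff)

lemma orbit_level_nonneg: "0 \<le> orbit_level A k \<theta>"
  by (simp add: orbit_level_def)

lemma orbit_level_pos_iff: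
  "0 < orbit_level A k \<theta> \<longleftrightarrow> cos \<theta> \<noteq> 0 \<or> k \<noteq> 0" if "A \<noteq> 0"
  using energy_pos[OF that, of k] that
  by (auto simp: orbit_level_def zero_less_divide_iff add_nonneg_pos add_pos_nonneg)

lemma slowness_nonneg: "0 \<le> slowness A k \<theta>"
  using log_mean_pos[of "orbit_level A k \<theta>"] orbit_level_nonneg[of A k \<theta>]
  by (cases "orbit_level A k \<theta> = 0") (auto simp: slowness_def)

lemma slowness_pos_iff: "0 < slowness A k \<theta> \<longleftrightarrow> cos \<theta> \<noteq> 0 \<or> k \<noteq> 0" if "A \<noteq> 0"
proof -
  have "0 < slowness A k \<theta> \<longleftrightarrow> 0 < orbit_level A k \<theta>"
    using log_mean_pos[of "orbit_level A k \<theta>"] orbit_level_nonneg[of A k \<theta>] energy_pos[OF that, of k]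
    by (cases "orbit_level A k \<theta> = 0") (auto simp: slowness_def)
  then show ?thesis using orbit_level_pos_iff[OF that] by simp
qed

lemma slowness_power2: "(slowness A k \<theta>)\<^sup>2 = (A\<^sup>2 + k\<^sup>2) * log_mean (orbit_level A k \<theta>)"
  using slowness_nonneg[of A k \<theta>] by (simp add: slowness_def)

text \<open>
  Conservation of energy, read off at phase \<open>\<theta>\<close>.
\<close>

lemma slowness_energy:
  assumes "A \<noteq> 0" "cos \<theta> \<noteq> 0 \<or> k \<noteq> 0"
  shows "(A * sin \<theta> / slowness A k \<theta>)\<^sup>2 = ln ((A\<^sup>2 + k\<^sup>2) / (A\<^sup>2 * (cos \<theta>)\<^sup>2 + k\<^sup>2))"
proof -
  define r where "r = orbit_level A k \<theta>"
  have r: "0 < r" using orbit_level_pos_iff assms by (simp add: r_def)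
  have E: "0 < A\<^sup>2 + k\<^sup>2" using energy_pos assms by blast
  have "(A * sin \<theta>)\<^sup>2 = (A\<^sup>2 + k\<^sup>2) * (1 - r)"
  proof -
    have "(A\<^sup>2 + k\<^sup>2) * r = A\<^sup>2 * (cos \<theta>)\<^sup>2 + k\<^sup>2"
      using E by (simp add: r_def orbit_level_def)
    then show ?thesis by (simp add: sin_squared_eq algebra_simps power_mult_distrib)
  qed
  also have "\<dots> = (slowness A k \<theta>)\<^sup>2 * ln (1 / r)"
    using log_mean_mult_ln[OF r] r by (simp add: slowness_power2 ln_div mult.assoc right_diff_distrib flip: r_def)
  finally show ?thesis
    using slowness_pos_iff[of A k \<theta>] assms by (simp add: power_divide r_def orbit_level_def)
qed

lemma slowness_sin_0: "slowness A k \<theta> = sqrt (A\<^sup>2 + k\<^sup>2)" if "sin \<theta> = 0" "A \<noteq> 0"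
  using that energy_pos[of A k] cos_squared_eq[of \<theta>]
  by (simp add: slowness_def orbit_level_def log_mean_def)

text \<open>
  Joint continuity in \<open>k\<close> and \<open>\<theta>\<close>, including \<open>k = 0\<close>, makes the period continuous in \<open>k\<close>.
\<close>

lemma continuous_on_slowness_param:
  fixes f g :: "'a :: t2_space \<Rightarrow> real"
  assumes "A \<noteq> 0" "continuous_on S f" "continuous_on S g"
  shows "continuous_on S (\<lambda>z. slowness A (f z) (g z))"
  using assms energy_pos[OF assms(1)] unfolding slowness_def orbit_level_def
  by (intro continuous_intros continuous_on_compose2[OF continuous_on_log_mean])
    (auto simp: less_imp_neq[THEN not_sym])

lemma isCont_slowness: "isCont (slowness A k) \<theta>" if "A \<noteq> 0"
  using continuous_on_slowness_param[OF that, of UNIV "\<lambda>_. k" "\<lambda>x. x"]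
  by (simp add: continuous_on_eq_continuous_at)

lemma slowness_plus_pi: "slowness A k (\<theta> + pi) = slowness A k \<theta>"
  by (simp add: slowness_def orbit_level_def)

lemma slowness_minus: "slowness A k (- \<theta>) = slowness A k \<theta>"
  by (simp add: slowness_def orbit_level_def)

section \<open>Analytic preliminaries and the Gaussian integral\<close>

lemma continuous_antiderivative:
  fixes f :: "real \<Rightarrow> real"
  assumes "\<And>x. isCont f x"
  obtains F where "F 0 = 0" "\<And>x. (F has_real_derivative f x) (at x)"
proof -
  obtain F where F: "\<And>x. (F has_real_derivative f x) (at x)"
    using einterval_antiderivative[of "-\<infinity>" "\<infinity>" f] assms
    by (auto simp: has_real_derivative_iff_has_vector_derivative)
  show ?thesis
    by (rule that[of "\<lambda>x. F x - F 0"]) (auto intro!: derivative_eq_intros F)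
qed

text \<open>
  If one factor vanishes at the point, the product rule needs no derivative of the other factor.
  This gives the acceleration at the turning points, where the slowness is only known to be continuous.
\<close>

lemma has_real_derivative_mult_vanishing:
  fixes f g :: "real \<Rightarrow> real"
  assumes "(f has_real_derivative D) (at a)" "f a = 0" "isCont g a"
  shows "((\<lambda>x. f x * g x) has_real_derivative D * g a) (at a)"
proof -
  obtain q where q: "\<And>z. f z - f a = q z * (z - a)" "isCont q a" "q a = D"
    using assms(1) unfolding CARAT_DERIV by blast
  show ?thesis
    unfolding CARAT_DERIV
    using q assms(2,3)
    by (intro exI[of _ "\<lambda>z. q z * g z"]) (auto intro!: continuous_intros)
qed

text \<open>
  The substitution \<open>s = exp (- v\<^sup>2)\<close> turns the integral into \<open>\<surd>2\<close> times the Gaussian integral over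
  the half-line.  The antiderivative is continuous on the closed interval because the Gaussian
  integral converges.
\<close>

lemma has_integral_limit_integrand:
  "(limit_integrand has_integral sqrt (pi / 2)) {0..1}"
proof -
  obtain H where H0: "H 0 = 0" and H: "\<And>v. (H has_real_derivative exp (- v\<^sup>2)) (at v)"
    by (rule continuous_antiderivative[of "\<lambda>v. exp (- v\<^sup>2)"]) auto
  have gauss: "integrable lborel (\<lambda>v::real. indicator {0..} v *\<^sub>R exp (- v\<^sup>2))"
    "(\<integral>v. indicator {0..} v *\<^sub>R exp (- v\<^sup>2) \<partial>lborel) = sqrt pi / 2"
    using gaussian_moment_0 by (auto simp: has_bochner_integral_iff)
  have "(H \<longlongrightarrow> sqrt pi / 2) at_top"
  proof (rule Lim_transform_eventually)
    show "((\<lambda>y. \<integral>v. indicator {..y} v *\<^sub>R (indicator {0..} v *\<^sub>R exp (- v\<^sup>2)) \<partial>lborel) \<longlongrightarrow> sqrt pi / 2) at_top"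
      using tendsto_integral_at_top[OF _ gauss(1)] unfolding gauss(2) by simp
    show "\<forall>\<^sub>F y in at_top. (\<integral>v. indicator {..y} v *\<^sub>R (indicator {0..} v *\<^sub>R exp (- v\<^sup>2)) \<partial>lborel) = H y"
      using eventually_ge_at_top[of 0]
    proof eventually_elim
      case (elim y)
      have "(\<integral>v. exp (- v\<^sup>2) * indicator {0..y} v \<partial>lborel) = H y - H 0"
        using elim H by (intro integral_FTC_Icc_real) auto
      moreover have "indicator {..y} v *\<^sub>R (indicator {0..} v *\<^sub>R exp (- v\<^sup>2)) = exp (- v\<^sup>2) * indicator {0..y} v" for v :: real
        by (auto simp: indicator_def)
      ultimately show ?case using H0 by (simp only: diff_0_right)
    qed
  qed
  moreover have "filterlim (\<lambda>s. sqrt (- ln s)) at_top (at_right (0::real))"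
    by (intro filterlim_compose[OF sqrt_at_top] filterlim_uminus_at_bot[THEN iffD1] ln_at_0)
  ultimately have lim0: "((\<lambda>s. H (sqrt (- ln s))) \<longlongrightarrow> sqrt pi / 2) (at_right 0)"
    by (rule filterlim_compose)
  (* The value at 0 is the limit from the right. *)
  define F where "F s = (if s = 0 then - sqrt 2 * (sqrt pi / 2) else - sqrt 2 * H (sqrt (- ln s)))" for s
  have "(limit_integrand has_integral F 1 - F 0) {0..1}"
  proof (rule fundamental_theorem_of_calculus_interior)
    show "continuous_on {0..1} F"
    proof (rule continuous_on_IccI)
      have "((\<lambda>s. - sqrt 2 * H (sqrt (- ln s))) \<longlongrightarrow> F 0) (at_right 0)"
        using tendsto_mult_left[OF lim0, of "- sqrt 2"] by (simp add: F_def)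
      then show "(F \<longlongrightarrow> F 0) (at_right 0)"
        by (rule Lim_transform_eventually, intro eventually_mono[OF eventually_at_right_less[of 0]])
          (simp add: F_def)
      have cont: "isCont F s" if "0 < s" for s
      proof -
        have "isCont (\<lambda>s. - sqrt 2 * H (sqrt (- ln s))) s"
          using that by (intro continuous_intros isCont_o2[OF _ DERIV_isCont[OF H]]) auto
        moreover have "\<forall>\<^sub>F s in nhds s. F s = - sqrt 2 * H (sqrt (- ln s))"
          by (rule eventually_mono[OF t1_space_nhds[of s 0]]) (use that in \<open>auto simp: F_def\<close>)
        ultimately show ?thesis using isCont_cong by fastforce
      qed
      show "(F \<longlongrightarrow> F s) (at s)" if "0 < s" for s
        using cont[OF that] by (simp add: isCont_def)
      show "(F \<longlongrightarrow> F 1) (at_left 1)"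
        using cont[of 1] by (simp add: isCont_def filterlim_at_split)
    qed simp
    fix s :: real assume s: "s \<in> {0<..<1}"
    have "sqrt (- 2 * ln s) = sqrt 2 * sqrt (- ln s)"
      using real_sqrt_mult[of 2 "- ln s"] by simp
    then have "- sqrt 2 * (exp (- (sqrt (- ln s))\<^sup>2) * (- (1 / s) * (inverse (sqrt (- ln s)) / 2))) = limit_integrand s"
      using s by (simp add: limit_integrand_def divide_simps)
    moreover have "((\<lambda>s. - sqrt 2 * H (sqrt (- ln s))) has_real_derivative
        - sqrt 2 * (exp (- (sqrt (- ln s))\<^sup>2) * (- (1 / s) * (inverse (sqrt (- ln s)) / 2)))) (at s)"
      using s by (intro DERIV_cmult DERIV_chain2[OF H] DERIV_chain2[OF DERIV_real_sqrt]) (auto intro!: derivative_eq_intros)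
    ultimately have "((\<lambda>s. - sqrt 2 * H (sqrt (- ln s))) has_real_derivative limit_integrand s) (at s)"
      by simp
    then show "(F has_vector_derivative limit_integrand s) (at s)"
      unfolding has_real_derivative_iff_has_vector_derivative[symmetric]
      by (rule has_field_derivative_transform_within_open[of _ _ _ "{0<..}"])
        (use s in \<open>auto simp: F_def\<close>)
  qed simp
  moreover have "F 1 - F 0 = sqrt (pi / 2)"
    by (simp add: F_def H0 real_sqrt_divide field_simps)
  ultimately show ?thesis by simp
qed

section \<open>The motion as the inverse of a clock\<close>

text \<open>
  The time at which phase \<open>\<theta>\<close> is reached.
\<close>

definition clock :: "real \<Rightarrow> real \<Rightarrow> real \<Rightarrow> real" where
  "clock A k = (SOME \<tau>. \<tau> 0 = 0 \<and> (\<forall>\<theta>. (\<tau> has_real_derivative slowness A k \<theta>) (at \<theta>)))"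

definition phase :: "real \<Rightarrow> real \<Rightarrow> real \<Rightarrow> real" where
  "phase A k = inv (clock A k)"

definition position :: "real \<Rightarrow> real \<Rightarrow> real \<Rightarrow> real" where
  "position A k t = A * cos (phase A k t)"

text \<open>
  At a collision (\<open>k = 0\<close>, \<open>cos \<theta> = 0\<close>) the slowness is \<open>0\<close> and the velocity is infinite; the value
  \<open>0\<close> it gets there by totalised division is meaningless.
\<close>

definition velocity :: "real \<Rightarrow> real \<Rightarrow> real \<Rightarrow> real" where
  "velocity A k t = - A * sin (phase A k t) / slowness A k (phase A k t)"

context
  fixes A k :: real
  assumes A: "A \<noteq> 0"
begin

lemma clock_0 [simp]: "clock A k 0 = 0"
  and DERIV_clock: "(clock A k has_real_derivative slowness A k \<theta>) (at \<theta>)"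
proof -
  have "\<exists>\<tau>. \<tau> 0 = 0 \<and> (\<forall>\<theta>. (\<tau> has_real_derivative slowness A k \<theta>) (at \<theta>))"
    using continuous_antiderivative[of "slowness A k"] isCont_slowness[OF A] by metis
  from someI_ex[OF this]
  show "clock A k 0 = 0" "(clock A k has_real_derivative slowness A k \<theta>) (at \<theta>)"
    unfolding clock_def by auto
qed

lemma isCont_clock: "isCont (clock A k) \<theta>"
  using DERIV_clock by (rule DERIV_isCont)

lemma clock_plus_pi: "clock A k (\<theta> + pi) = clock A k \<theta> + clock A k pi"
proof -
  have "((\<lambda>\<theta>. clock A k (\<theta> + pi) - clock A k \<theta>) has_real_derivative 0) (at \<theta>)" for \<theta>
    by (rule derivative_eq_intros DERIV_chain2[OF DERIV_clock] refl)+ (simp add: slowness_plus_pi)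
  then have "clock A k (\<theta> + pi) - clock A k \<theta> = clock A k (0 + pi) - clock A k 0"
    by (intro DERIV_isconst_all) blast
  then show ?thesis by simp
qed

lemma clock_minus: "clock A k (- \<theta>) = - clock A k \<theta>"
proof -
  have "((\<lambda>\<theta>. clock A k (- \<theta>) + clock A k \<theta>) has_real_derivative 0) (at \<theta>)" for \<theta>
    by (rule derivative_eq_intros DERIV_chain2[OF DERIV_clock] refl)+ (simp add: slowness_minus)
  then have "clock A k (- \<theta>) + clock A k \<theta> = clock A k (- 0) + clock A k 0"
    by (intro DERIV_isconst_all) blast
  then show ?thesis by simp
qed

text \<open>
  Together with the evenness of the slowness, its period \<open>\<pi>\<close> cuts an oscillation into four quarters of equal duration.
\<close>

lemma clock_pi: "clock A k pi = 2 * clock A k (pi / 2)"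
  using clock_plus_pi[of "- (pi / 2)"] clock_minus[of "pi / 2"] by simp

lemma clock_plus_2pi: "clock A k (\<theta> + 2 * pi) = clock A k \<theta> + 4 * clock A k (pi / 2)"
  using clock_plus_pi[of \<theta>] clock_plus_pi[of "\<theta> + pi"] by (simp add: clock_pi add.assoc)

text \<open>
  The slowness is nonnegative and vanishes at most where the cosine does, hence on no interval.
\<close>

lemma strict_mono_clock: "strict_mono (clock A k)"
proof (rule strict_monoI)
  fix a b :: real assume ab: "a < b"
  have mono: "clock A k u \<le> clock A k v" if "u \<le> v" for u v
    using that DERIV_clock slowness_nonneg by (meson DERIV_nonneg_imp_nondecreasing)
  show "clock A k a < clock A k b"
  proof (rule ccontr)
    assume "\<not> clock A k a < clock A k b"
    then have const: "clock A k u = clock A k a" if "u \<in> {a..b}" for u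
      using mono[of a u] mono[of u b] that by simp
    have cos0: "cos u = 0" if u: "u \<in> {a<..<b}" for u
    proof -
      have "((\<lambda>_. clock A k a) has_real_derivative slowness A k u) (at u)"
        by (rule has_field_derivative_transform_within_open[OF DERIV_clock, where S = "{a<..<b}"])
          (use u in \<open>auto intro: const\<close>)
      then have "slowness A k u = 0"
        using DERIV_unique DERIV_const by blast
      then show ?thesis using slowness_pos_iff[OF A, of k u] by auto
    qed
    (* The cosine would vanish at two points at distance less than \<pi>. *)
    define m where "m = (a + b) / 2"
    define e where "e = min ((b - a) / 4) 1"
    have e: "0 < e" "e < pi" "m \<in> {a<..<b}" "m + e \<in> {a<..<b}"
      using ab pi_gt3 by (auto simp: e_def m_def min_def field_simps)
    have "cos (m + e) = - sin m * sin e" using cos0[OF e(3)] by (simp add: cos_add)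
    moreover have "sin m \<noteq> 0" using cos0[OF e(3)] sin_zero_abs_cos_one[of m] by auto
    ultimately show False using cos0[OF e(4)] sin_gt_zero[OF e(1,2)] by simp
  qed
qed

lemma clock_pos_iff [simp]: "0 < clock A k \<theta> \<longleftrightarrow> 0 < \<theta>"
  using strict_mono_less[OF strict_mono_clock, of 0 \<theta>] by simp

lemma clock_plus_nat: "clock A k (real n * pi) = real n * clock A k pi"
  by (induction n) (auto simp: clock_plus_pi distrib_right add.commute[of pi])

lemma surj_clock: "surj (clock A k)"
proof -
  have "\<exists>\<theta>. clock A k \<theta> = t" for t
  proof -
    obtain n where n: "\<bar>t\<bar> \<le> real n * clock A k pi"
      using reals_Archimedean3[of "clock A k pi"] pi_gt_zero clock_pos_iff
      by (metis less_imp_le)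
    have "\<exists>\<theta>\<ge>- (real n * pi). \<theta> \<le> real n * pi \<and> clock A k \<theta> = t"
      using n isCont_clock
      by (intro IVT) (auto simp: clock_minus clock_plus_nat)
    then show ?thesis by blast
  qed
  then show ?thesis by (metis surj_def)
qed

lemma clock_phase [simp]: "clock A k (phase A k t) = t"
  by (simp add: phase_def surj_clock surj_f_inv_f)

lemma phase_clock [simp]: "phase A k (clock A k \<theta>) = \<theta>"
  by (simp add: phase_def strict_mono_clock strict_mono_imp_inj_on)

lemma phase_0 [simp]: "phase A k 0 = 0"
  using phase_clock[of 0] by simp

lemma phase_pos_iff [simp]: "0 < phase A k t \<longleftrightarrow> 0 < t"
  using clock_pos_iff[of "phase A k t"] by simp

lemma isCont_phase: "isCont (phase A k) t"
  using isCont_inverse_function[of 1 "phase A k t" "phase A k" "clock A k"] isCont_clock by simp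

lemma phase_plus_period: "phase A k (t + 4 * clock A k (pi / 2)) = phase A k t + 2 * pi"
  using phase_clock[of "phase A k t + 2 * pi"] by (simp only: clock_plus_2pi clock_phase)

lemma DERIV_phase:
  assumes "slowness A k (phase A k t) \<noteq> 0"
  shows "(phase A k has_real_derivative 1 / slowness A k (phase A k t)) (at t)"
  using DERIV_inverse_function[where f = "clock A k" and g = "phase A k" and x = t
      and a = "t - 1" and b = "t + 1", OF DERIV_clock assms] isCont_phase
  by (simp add: inverse_eq_divide)

lemma position_0 [simp]: "position A k 0 = A"
  by (simp add: position_def)

lemma velocity_0 [simp]: "velocity A k 0 = 0"
  by (simp add: velocity_def)

lemma isCont_position: "isCont (position A k) t"
  unfolding position_def by (intro continuous_intros isCont_phase)

lemma position_velocity_periodic: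
  "position A k (t + 4 * clock A k (pi / 2)) = position A k t"
  "velocity A k (t + 4 * clock A k (pi / 2)) = velocity A k t"
  by (simp_all add: position_def velocity_def phase_plus_period slowness_def orbit_level_def)

text \<open>
  The extreme position \<open>A\<close> is only attained at the phases in \<open>2\<pi>\<int>\<close>, so nothing shorter than a full
  turn of the phase can be a period.
\<close>

lemma period_le:
  assumes "position A k S = A" "0 < S"
  shows "4 * clock A k (pi / 2) \<le> S"
proof -
  have "cos (phase A k S) = 1" using assms(1) A by (simp add: position_def)
  then obtain n :: int where n: "phase A k S = of_int n * 2 * pi"
    using cos_one_2pi_int by blast
  have "0 < phase A k S" using assms(2) by simp
  then have "1 \<le> n" unfolding n by (simp add: zero_less_mult_iff)
  then have "2 * pi \<le> phase A k S" unfolding n by simp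
  then have "clock A k (0 + 2 * pi) \<le> clock A k (phase A k S)"
    unfolding strict_mono_less_eq[OF strict_mono_clock] by simp
  then show ?thesis unfolding clock_plus_2pi by simp
qed

lemma minimal_period_pos: "0 < 4 * clock A k (pi / 2)"
  by simp

lemma has_minimal_period_position: "has_minimal_period (position A k) (4 * clock A k (pi / 2))"
  unfolding has_minimal_period_def
proof (intro conjI allI impI minimal_period_pos)
  show "periodic_fun_simple (position A k) (4 * clock A k (pi / 2))"
    by standard (rule position_velocity_periodic)
  fix S :: real assume "0 < S" and per: "periodic_fun_simple (position A k) S"
  then show "4 * clock A k (pi / 2) \<le> S"
    using periodic_fun_simple.plus_period[OF per, of 0] by (intro period_le) auto
qed

lemma position_slow_iff: "slowness A k (phase A k t) \<noteq> 0 \<longleftrightarrow> position A k t \<noteq> 0 \<or> k \<noteq> 0"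
  using slowness_pos_iff[OF A, of k "phase A k t"] slowness_nonneg[of A k "phase A k t"] A
  by (auto simp: position_def)

lemma DERIV_position:
  assumes "position A k t \<noteq> 0 \<or> k \<noteq> 0"
  shows "(position A k has_real_derivative velocity A k t) (at t)"
  unfolding position_def velocity_def
  using assms[folded position_slow_iff]
  by (auto intro!: derivative_eq_intros DERIV_phase)

lemma velocity_energy:
  assumes "position A k t \<noteq> 0 \<or> k \<noteq> 0"
  shows "(velocity A k t)\<^sup>2 = ln ((A\<^sup>2 + k\<^sup>2) / ((position A k t)\<^sup>2 + k\<^sup>2))"
  using slowness_energy[OF A, where k = k and \<theta> = "phase A k t"] assms A
  by (simp add: velocity_def position_def power_mult_distrib power_divide)

lemma isCont_velocity:
  assumes "position A k t \<noteq> 0 \<or> k \<noteq> 0"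
  shows "isCont (velocity A k) t"
  unfolding velocity_def using assms[folded position_slow_iff]
  by (intro continuous_intros isCont_o2[OF isCont_phase] isCont_slowness A isCont_phase) auto

lemma open_regular_times: "open {t. position A k t \<noteq> 0 \<or> k \<noteq> 0}"
proof (cases "k = 0")
  case True
  have "open {t. position A k t \<noteq> 0}"
    by (intro open_Collect_neq continuous_at_imp_continuous_on ballI isCont_position continuous_on_const)
  then show ?thesis using True by simp
qed simp

text \<open>
  Away from the turning points, energy conservation expresses the velocity locally as a signed square
  root of a differentiable function of the position.  At a turning point that square root has radicand
  \<open>0\<close>; there the factor \<open>sin\<close> of the velocity vanishes and the other factor is continuous.
\<close>

lemma DERIV_velocity:
  assumes t: "position A k t \<noteq> 0 \<or> k \<noteq> 0"
  shows "(velocity A k has_real_derivative - position A k t / ((position A k t)\<^sup>2 + k\<^sup>2)) (at t)"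
proof (cases "velocity A k t = 0")
  case True
  let ?w = "slowness A k (phase A k t)"
  have w: "?w \<noteq> 0" using t position_slow_iff by blast
  have sin0: "sin (phase A k t) = 0" using True A w by (simp add: velocity_def)
  have w2: "?w * ?w = A\<^sup>2 + k\<^sup>2"
    using slowness_sin_0[OF sin0 A, of k] energy_pos[OF A, of k] by simp
  have "((\<lambda>t. - A * sin (phase A k t)) has_real_derivative - A * cos (phase A k t) / ?w) (at t)"
    by (auto intro!: derivative_eq_intros DERIV_phase w)
  moreover have "isCont (\<lambda>t. 1 / slowness A k (phase A k t)) t"
    using w by (intro continuous_intros isCont_o2[OF isCont_phase] isCont_slowness A) auto
  ultimately have "((\<lambda>t. - A * sin (phase A k t) * (1 / slowness A k (phase A k t)))
      has_real_derivative - A * cos (phase A k t) / ?w * (1 / ?w)) (at t)"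
    using sin0 by (intro has_real_derivative_mult_vanishing) auto
  moreover have "- A * cos (phase A k t) / ?w * (1 / ?w) = - position A k t / ((position A k t)\<^sup>2 + k\<^sup>2)"
    using w2 cos_squared_eq[of "phase A k t"] sin0 by (simp add: position_def power_mult_distrib)
  moreover have "velocity A k = (\<lambda>t. - A * sin (phase A k t) * (1 / slowness A k (phase A k t)))"
    by (simp add: velocity_def fun_eq_iff)
  ultimately show ?thesis by simp
next
  case False
  define \<sigma> where "\<sigma> = sgn (velocity A k t)"
  let ?e = "\<lambda>s. ln ((A\<^sup>2 + k\<^sup>2) / ((position A k s)\<^sup>2 + k\<^sup>2))"
  have pos: "0 < (position A k s)\<^sup>2 + k\<^sup>2" if "position A k s \<noteq> 0 \<or> k \<noteq> 0" for s
    using that by (simp add: sum_power2_gt_zero_iff)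
  have e: "0 < ?e t" using False velocity_energy[OF t] by (metis zero_less_power2)
  have "\<sigma> * sqrt (?e t) = velocity A k t"
    using velocity_energy[OF t, symmetric] by (simp add: \<sigma>_def sgn_mult_abs)
  moreover have "\<sigma> * \<sigma> = 1" using False by (simp add: \<sigma>_def sgn_if)
  ultimately have \<sigma>: "velocity A k t / sqrt (?e t) = \<sigma>"
    using e by (metis less_irrefl nonzero_mult_div_cancel_right real_sqrt_eq_zero_cancel_iff)
  have "((\<lambda>s. ln (A\<^sup>2 + k\<^sup>2) - ln ((position A k s)\<^sup>2 + k\<^sup>2)) has_real_derivative
      - 2 * position A k t * velocity A k t / ((position A k t)\<^sup>2 + k\<^sup>2)) (at t)"
    using pos[OF t] by (auto intro!: derivative_eq_intros DERIV_position t)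
  then have de: "(?e has_real_derivative - 2 * position A k t * velocity A k t / ((position A k t)\<^sup>2 + k\<^sup>2)) (at t)"
    by (rule has_field_derivative_transform_within_open[OF _ open_regular_times])
      (use t A energy_pos[OF A, of k] pos in \<open>simp_all add: ln_div\<close>)
  have regroup: "\<sigma> * (inverse r / 2 * (- 2 * p * v / q)) = (\<sigma> * (v / r)) * (- p / q)" for p q r v :: real
    by (cases "q = 0"; cases "r = 0") (simp_all add: field_simps)
  have "((\<lambda>s. \<sigma> * sqrt (?e s)) has_real_derivative
      \<sigma> * (inverse (sqrt (?e t)) / 2 * (- 2 * position A k t * velocity A k t / ((position A k t)\<^sup>2 + k\<^sup>2)))) (at t)"
    by (intro DERIV_cmult DERIV_chain2[where f = sqrt] DERIV_real_sqrt e de)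
  also have "\<sigma> * (inverse (sqrt (?e t)) / 2 * (- 2 * position A k t * velocity A k t / ((position A k t)\<^sup>2 + k\<^sup>2)))
      = (\<sigma> * (velocity A k t / sqrt (?e t))) * (- position A k t / ((position A k t)\<^sup>2 + k\<^sup>2))"
    by (rule regroup)
  also have "\<dots> = - position A k t / ((position A k t)\<^sup>2 + k\<^sup>2)"
    unfolding \<sigma> \<open>\<sigma> * \<sigma> = 1\<close> by simp
  finally have der: "((\<lambda>s. \<sigma> * sqrt (?e s)) has_real_derivative - position A k t / ((position A k t)\<^sup>2 + k\<^sup>2)) (at t)" .
  have "\<forall>\<^sub>F s in nhds t. velocity A k s = \<sigma> * sqrt (?e s)"
  proof -
    have "((\<lambda>s. \<sigma> * velocity A k s) \<longlongrightarrow> \<sigma> * velocity A k t) (nhds t)"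
      using isCont_velocity[OF t]
      by (intro tendsto_mult_left) (simp add: isCont_def tendsto_at_iff_tendsto_nhds)
    moreover have "0 < \<sigma> * velocity A k t" using False by (auto simp: \<sigma>_def sgn_if)
    ultimately have "\<forall>\<^sub>F s in nhds t. 0 < \<sigma> * velocity A k s"
      using order_tendstoD(1) by blast
    moreover have "\<forall>\<^sub>F s in nhds t. position A k s \<noteq> 0 \<or> k \<noteq> 0"
      using eventually_nhds_in_open[OF open_regular_times, of t] t by simp
    ultimately show ?thesis
    proof eventually_elim
      case (elim s)
      have "sgn (velocity A k s) = \<sigma>"
        using elim(1) by (auto simp: \<sigma>_def sgn_if split: if_splits)
      then show ?case
        using velocity_energy[OF elim(2), symmetric] by (metis real_sqrt_abs sgn_mult_abs)
    qed
  qed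
  from DERIV_cong_ev[OF refl this refl] der show ?thesis by blast
qed

end

section \<open>The period as an integral\<close>

context
  fixes A k :: real
  assumes A: "A \<noteq> 0"
begin

text \<open>
  Substituting \<open>s = cos \<theta>\<close>: the time needed to fall from \<open>A\<close> to \<open>A s\<close>, divided by \<open>\<bar>A\<bar>\<close>, is up to
  sign an antiderivative of the integrand, continuous also at \<open>s = 1\<close>, where the integrand is singular.
  The case \<open>k = 0\<close> is included.
\<close>

lemma has_integral_period_integrand:
  "(period_integrand A k has_integral clock A k (pi / 2) / \<bar>A\<bar>) {0..1}"
proof -
  define F where "F s = - clock A k (arccos s) / \<bar>A\<bar>" for s
  have "(period_integrand A k has_integral F 1 - F 0) {0..1}"
  proof (rule fundamental_theorem_of_calculus_interior)
    show "continuous_on {0..1} F"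
      unfolding F_def
      using A by (intro continuous_intros continuous_on_compose2[OF continuous_at_imp_continuous_on[of UNIV "clock A k"]])
        (auto intro: isCont_clock[OF A])
    fix s :: real assume s: "s \<in> {0<..<1}"
    define \<theta> where "\<theta> = arccos s"
    have cos: "cos \<theta> = s" and sin: "sin \<theta> = sqrt (1 - s\<^sup>2)"
      using s by (auto simp: \<theta>_def sin_arccos)
    have sin_pos: "0 < sqrt (1 - s\<^sup>2)" using s by (simp add: power_less_one_iff)
    have w: "0 < slowness A k \<theta>" using slowness_pos_iff[OF A] cos s by auto
    have "sqrt (ln ((A\<^sup>2 + k\<^sup>2) / (A\<^sup>2 * s\<^sup>2 + k\<^sup>2))) = sqrt ((A * sin \<theta> / slowness A k \<theta>)\<^sup>2)"
      using slowness_energy[OF A, where k = k and \<theta> = \<theta>] cos s by simp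
    also have "\<dots> = \<bar>A\<bar> * sqrt (1 - s\<^sup>2) / slowness A k \<theta>"
      using w sin sin_pos by (simp only: real_sqrt_abs) (simp add: abs_mult)
    finally have "period_integrand A k s = - (slowness A k \<theta> * inverse (- sqrt (1 - s\<^sup>2))) / \<bar>A\<bar>"
      by (simp add: period_integrand_def field_simps)
    moreover have "(F has_real_derivative - (slowness A k \<theta> * inverse (- sqrt (1 - s\<^sup>2))) / \<bar>A\<bar>) (at s)"
      unfolding F_def \<theta>_def
      using s by (intro DERIV_cdivide DERIV_minus DERIV_chain2[OF DERIV_clock[OF A]] DERIV_arccos) auto
    ultimately show "(F has_vector_derivative period_integrand A k s) (at s)"
      by (simp add: has_real_derivative_iff_has_vector_derivative)
  qed simp
  then show ?thesis using A by (simp add: F_def clock_0)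
qed

section \<open>Collisions and the weak solution\<close>

text \<open>
  At a collision the clock has derivative \<open>0\<close>.  If the position were differentiable there, the chain rule
  would give \<open>A cos \<theta>\<close>, which is the position as a function of the phase, the derivative \<open>0\<close> at a zero of the cosine.
\<close>

lemma not_differentiable_position:
  assumes "position A k t = 0" "k = 0"
  shows "\<not> position A k differentiable (at t)"
proof
  assume "position A k differentiable (at t)"
  then obtain D where D: "(position A k has_real_derivative D) (at t)"
    by (auto simp: real_differentiable_def)
  have cos0: "cos (phase A k t) = 0" using assms A by (simp add: position_def)
  have w: "slowness A k (phase A k t) = 0"
    using slowness_pos_iff[OF A, of k "phase A k t"] slowness_nonneg[of A k "phase A k t"] cos0 assms(2) by simp
  have "((\<lambda>\<theta>. position A k (clock A k \<theta>)) has_real_derivative D * slowness A k (phase A k t)) (at (phase A k t))"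
    using D by (intro DERIV_chain2[OF _ DERIV_clock[OF A]]) (simp add: A)
  moreover have "((\<lambda>\<theta>. A * cos \<theta>) has_real_derivative - A * sin (phase A k t)) (at (phase A k t))"
    by (auto intro!: derivative_eq_intros)
  ultimately have "- A * sin (phase A k t) = 0"
    using w by (auto simp: position_def phase_clock[OF A] dest: DERIV_unique)
  then show False using A cos0 sin_zero_abs_cos_one[of "phase A k t"] by auto
qed

text \<open>
  Two zeros of the cosine at distance less than \<open>\<pi>\<close> coincide.
\<close>

lemma isolated_zeros_position:
  assumes "position A k t = 0"
  shows "t isolated_in {t. position A k t = 0}"
proof -
  have zero: "position A k s = 0 \<longleftrightarrow> cos (phase A k s) = 0" for s
    using A by (simp add: position_def)
  define T where "T = phase A k -` ball (phase A k t) pi"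
  have "open T"
    unfolding T_def using isCont_phase[OF A]
    by (intro open_vimage continuous_at_imp_continuous_on) auto
  moreover have "T \<inter> {s. position A k s = 0} = {t}"
  proof -
    have "s = t" if "s \<in> T" "position A k s = 0" for s
    proof -
      let ?d = "phase A k s - phase A k t"
      have "sin ?d = 0" using that assms by (simp add: zero sin_diff)
      moreover have "\<bar>?d\<bar> < pi" using that by (simp add: T_def dist_real_def abs_minus_commute)
      ultimately have "?d = 0" using sin_eq_0_pi[of ?d] by auto
      then show "s = t" by (metis clock_phase[OF A] eq_iff_diff_eq_0)
    qed
    then show ?thesis using assms by (auto simp: T_def)
  qed
  ultimately show ?thesis unfolding isolated_in_def using assms by blast
qed

end

lemma closure_Compl_discrete:
  fixes S :: "'a :: perfect_space set"
  assumes "discrete S"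
  shows "closure (- S) = UNIV"
proof -
  have "interior S = {}"
  proof (rule ccontr)
    assume "interior S \<noteq> {}"
    then obtain x where x: "x \<in> interior S" by blast
    then obtain T where T: "open T" "T \<inter> S = {x}"
      using assms interior_subset unfolding discrete_def isolated_in_def by blast
    then have "open {x}"
      using x interior_subset[of S] by (metis Int_absorb2 Int_assoc Int_commute inf.absorb_iff2 open_Int open_interior insert_subset empty_subsetI)
    then show False using not_open_singleton by blast
  qed
  then show ?thesis by (simp add: closure_complement)
qed

text \<open>
  For \<open>k = 0\<close> the phase runs through the collisions without stopping, so the position is continued with
  the opposite sign.  The equation holds wherever the position is nonzero.
\<close>

lemma weak_C0_periodic_solution_position:
  assumes A: "A \<noteq> 0"
  shows "weak_C0_periodic_solution (position A 0)"
  unfolding weak_C0_periodic_solution_def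
proof (intro conjI exI allI impI ballI)
  let ?x = "position A 0" and ?U = "{t. position A 0 t \<noteq> 0}"
  show "continuous_on UNIV ?x"
    using isCont_position[OF A] by (intro continuous_at_imp_continuous_on) auto
  show "0 < 4 * clock A 0 (pi / 2)" "periodic_fun_simple ?x (4 * clock A 0 (pi / 2))"
    using has_minimal_period_position[OF A, of 0] by (auto simp: has_minimal_period_def)
  show U: "open ?U" using open_regular_times[OF A, of 0] by simp
  show disc: "discrete (- ?U)"
    using isolated_zeros_position[OF A, of 0] by (simp add: discrete_def Compl_eq)
  show "closure ?U = UNIV" using closure_Compl_discrete[OF disc] by simp
  fix t
  show "\<not> of_class_C1_at ?x t" if "t \<notin> ?U"
  proof
    assume "of_class_C1_at ?x t"
    then have "?x differentiable (at t)"
      unfolding of_class_C1_at_def C1_differentiable_on_def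
      by (auto intro: differentiableI_vector)
    then show False using not_differentiable_position[OF A, of 0 t] that by simp
  qed
  assume t: "t \<in> ?U"
  have x: "(?x has_real_derivative velocity A 0 s) (at s)" if "s \<in> ?U" for s
    using DERIV_position[OF A, of 0 s] that by simp
  have v: "(deriv ?x has_real_derivative - 1 / ?x t) (at t)"
  proof (rule has_field_derivative_transform_within_open[OF _ U t])
    show "(velocity A 0 has_real_derivative - 1 / ?x t) (at t)"
      using DERIV_velocity[OF A, of 0 t] t by (simp add: power2_eq_square)
  qed (use x DERIV_imp_deriv in force)
  show "?x differentiable at t" "deriv ?x differentiable at t"
    using x[OF t] v real_differentiable_def by blast+
  show "?x t * deriv (deriv ?x) t + 1 = 0"
    using DERIV_imp_deriv[OF v] t by simp
qed

section \<open>The planar system\<close>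

lemma planar_solution_position_velocity:
  assumes "A \<noteq> 0" "k \<noteq> 0"
  shows "planar_solution k A (\<lambda>t. (position A k t, velocity A k t))"
  unfolding planar_solution_def planar_field_def
  using assms DERIV_position[of A k] DERIV_velocity[of A k]
  by (auto intro!: has_vector_derivative_Pair simp: has_real_derivative_iff_has_vector_derivative
      position_0 velocity_0)

lemma force_lipschitz:
  fixes x z k :: real
  assumes "k \<noteq> 0"
  shows "\<bar>x / (x\<^sup>2 + k\<^sup>2) - z / (z\<^sup>2 + k\<^sup>2)\<bar> \<le> \<bar>x - z\<bar> / k\<^sup>2"
proof -
  have k: "0 < k\<^sup>2" using assms by simp
  have pos: "0 < x\<^sup>2 + k\<^sup>2" "0 < z\<^sup>2 + k\<^sup>2" using k by (auto intro: add_nonneg_pos)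
  have difference: "x / (x\<^sup>2 + k\<^sup>2) - z / (z\<^sup>2 + k\<^sup>2) = (x - z) * ((k\<^sup>2 - x * z) / ((x\<^sup>2 + k\<^sup>2) * (z\<^sup>2 + k\<^sup>2)))"
    using pos assms by (simp add: divide_simps) (simp add: algebra_simps power2_eq_square)
  have "\<bar>(k\<^sup>2 - x * z) / ((x\<^sup>2 + k\<^sup>2) * (z\<^sup>2 + k\<^sup>2))\<bar> \<le> 1 / k\<^sup>2"
  proof -
    have "\<bar>x * z\<bar> \<le> x\<^sup>2 + z\<^sup>2"
      using sum_squares_bound[of "\<bar>x\<bar>" "\<bar>z\<bar>"] mult_nonneg_nonneg[OF abs_ge_zero[of x] abs_ge_zero[of z]]
      unfolding abs_mult power2_abs by linarith
    then have "\<bar>k\<^sup>2 - x * z\<bar> \<le> k\<^sup>2 + x\<^sup>2 + z\<^sup>2"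
      using k by linarith
    then have "\<bar>k\<^sup>2 - x * z\<bar> * k\<^sup>2 \<le> (k\<^sup>2 + x\<^sup>2 + z\<^sup>2) * k\<^sup>2"
      using k by (intro mult_right_mono) auto
    also have "\<dots> \<le> (x\<^sup>2 + k\<^sup>2) * (z\<^sup>2 + k\<^sup>2)"
      by (simp add: algebra_simps)
    finally show ?thesis using pos k by (simp add: abs_mult divide_simps)
  qed
  from mult_left_mono[OF this abs_ge_zero[of "x - z"]] show ?thesis
    unfolding difference abs_mult[of "x - z"] by simp
qed

text \<open>
  Gronwall's argument: \<open>f t * exp (- C t)\<close> is nonincreasing and \<open>f t * exp (C t)\<close> is nondecreasing.
  The first bounds \<open>f\<close> to the right of \<open>0\<close>, the second to the left.
\<close>

lemma gronwall_zero:
  fixes f f' :: "real \<Rightarrow> real"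
  assumes der: "\<And>t. (f has_real_derivative f' t) (at t)"
    and bound: "\<And>t. \<bar>f' t\<bar> \<le> C * f t" and "f 0 = 0" and nonneg: "\<And>t. 0 \<le> f t"
  shows "f t = 0"
proof (cases "0 \<le> t")
  case True
  have "f t * exp (- C * t) \<le> f 0 * exp (- C * 0)"
  proof (rule DERIV_nonpos_imp_nonincreasing[OF True])
    fix s
    have "((\<lambda>s. f s * exp (- C * s)) has_real_derivative (f' s - C * f s) * exp (- C * s)) (at s)"
      by (auto intro!: derivative_eq_intros der simp: algebra_simps)
    moreover have "(f' s - C * f s) * exp (- C * s) \<le> 0"
      using bound[of s] by (intro mult_nonpos_nonneg) auto
    ultimately show "\<exists>y. ((\<lambda>s. f s * exp (- C * s)) has_real_derivative y) (at s) \<and> y \<le> 0" by blast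
  qed
  then show ?thesis using assms(3) nonneg[of t] by (simp add: mult_le_0_iff)
next
  case False
  then have t: "t \<le> 0" by simp
  have "f t * exp (C * t) \<le> f 0 * exp (C * 0)"
  proof (rule DERIV_nonneg_imp_nondecreasing[OF t])
    fix s
    have "((\<lambda>s. f s * exp (C * s)) has_real_derivative (f' s + C * f s) * exp (C * s)) (at s)"
      by (auto intro!: derivative_eq_intros der simp: algebra_simps)
    moreover have "0 \<le> (f' s + C * f s) * exp (C * s)"
      using bound[of s] by (intro mult_nonneg_nonneg) auto
    ultimately show "\<exists>y. ((\<lambda>s. f s * exp (C * s)) has_real_derivative y) (at s) \<and> 0 \<le> y" by blast
  qed
  then show ?thesis using assms(3) nonneg[of t] by (simp add: mult_le_0_iff)
qed

text \<open>
  The force is globally Lipschitz for \<open>k \<noteq> 0\<close>, so the squared distance of two solutions satisfies a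
  linear differential inequality.
\<close>

lemma planar_solution_unique:
  assumes "k \<noteq> 0" "planar_solution k A \<gamma>" "planar_solution k A \<delta>"
  shows "\<gamma> = \<delta>"
proof -
  have comp: "((\<lambda>t. fst (\<phi> t)) has_real_derivative snd (\<phi> t)) (at t)"
    "((\<lambda>t. snd (\<phi> t)) has_real_derivative - fst (\<phi> t) / ((fst (\<phi> t))\<^sup>2 + k\<^sup>2)) (at t)"
    if "planar_solution k A \<phi>" for \<phi> t
  proof -
    have "(\<phi> has_vector_derivative planar_field k (\<phi> t)) (at t)"
      using that by (simp add: planar_solution_def)
    from bounded_linear.has_vector_derivative[OF bounded_linear_fst this]
      bounded_linear.has_vector_derivative[OF bounded_linear_snd this]
    show "((\<lambda>t. fst (\<phi> t)) has_real_derivative snd (\<phi> t)) (at t)"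
      "((\<lambda>t. snd (\<phi> t)) has_real_derivative - fst (\<phi> t) / ((fst (\<phi> t))\<^sup>2 + k\<^sup>2)) (at t)"
      by (simp_all add: planar_field_def case_prod_beta has_real_derivative_iff_has_vector_derivative)
  qed
  define a where "a t = fst (\<gamma> t) - fst (\<delta> t)" for t
  define b where "b t = snd (\<gamma> t) - snd (\<delta> t)" for t
  define h where "h t = fst (\<gamma> t) / ((fst (\<gamma> t))\<^sup>2 + k\<^sup>2) - fst (\<delta> t) / ((fst (\<delta> t))\<^sup>2 + k\<^sup>2)" for t
  have a: "(a has_real_derivative b t) (at t)" for t
    unfolding a_def b_def by (intro DERIV_diff comp assms)
  have b: "(b has_real_derivative - h t) (at t)" for t
    unfolding b_def h_def using DERIV_diff[OF comp(2)[OF assms(2)] comp(2)[OF assms(3)]] by simp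
  have h: "\<bar>h t\<bar> \<le> \<bar>a t\<bar> / k\<^sup>2" for t
    unfolding h_def a_def by (rule force_lipschitz[OF assms(1)])
  have "(a t)\<^sup>2 + (b t)\<^sup>2 = 0" for t
  proof (rule gronwall_zero[where f = "\<lambda>t. (a t)\<^sup>2 + (b t)\<^sup>2" and C = "1 + 1 / k\<^sup>2"])
    fix t
    show "((\<lambda>t. (a t)\<^sup>2 + (b t)\<^sup>2) has_real_derivative 2 * b t * (a t - h t)) (at t)"
      by (auto intro!: derivative_eq_intros a b simp: algebra_simps)
    have "\<bar>2 * b t * (a t - h t)\<bar> \<le> 2 * \<bar>b t\<bar> * (\<bar>a t\<bar> + \<bar>a t\<bar> / k\<^sup>2)"
      unfolding abs_mult using h[of t] by (intro mult_mono) auto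
    also have "\<dots> = (1 + 1 / k\<^sup>2) * (2 * \<bar>a t\<bar> * \<bar>b t\<bar>)"
      by (simp add: algebra_simps)
    also have "\<dots> \<le> (1 + 1 / k\<^sup>2) * ((a t)\<^sup>2 + (b t)\<^sup>2)"
      using sum_squares_bound[of "\<bar>a t\<bar>" "\<bar>b t\<bar>"] by (intro mult_left_mono) auto
    finally show "\<bar>2 * b t * (a t - h t)\<bar> \<le> (1 + 1 / k\<^sup>2) * ((a t)\<^sup>2 + (b t)\<^sup>2)" .
  qed (use assms in \<open>auto simp: planar_solution_def a_def b_def\<close>)
  then show ?thesis by (auto simp: sum_power2_eq_zero_iff a_def b_def fun_eq_iff prod_eq_iff)
qed

lemma has_minimal_period_planar_solution:
  assumes "A \<noteq> 0" "k \<noteq> 0" "planar_solution k A \<gamma>"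
  shows "has_minimal_period \<gamma> (4 * clock A k (pi / 2))"
proof -
  have \<gamma>: "\<gamma> = (\<lambda>t. (position A k t, velocity A k t))"
    using planar_solution_unique planar_solution_position_velocity assms by blast
  show ?thesis
    unfolding has_minimal_period_def
  proof (intro conjI allI impI minimal_period_pos assms)
    show "periodic_fun_simple \<gamma> (4 * clock A k (pi / 2))"
      by standard (simp add: \<gamma> position_velocity_periodic assms)
    fix S :: real assume S: "0 < S" and per: "periodic_fun_simple \<gamma> S"
    have "position A k S = A"
      using periodic_fun_simple.plus_period[OF per, of 0] assms by (simp add: \<gamma> position_0)
    then show "4 * clock A k (pi / 2) \<le> S"
      using S by (intro period_le assms)
  qed
qed

lemma has_minimal_period_unique: "S = T" if "has_minimal_period f S" "has_minimal_period f T"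
  using that by (auto simp: has_minimal_period_def intro: order.antisym)

section \<open>The periods and their limit\<close>

lemma orbit_period_eq_clock:
  assumes "A \<noteq> 0" "k \<noteq> 0"
  shows "orbit_period A k = 4 * clock A k (pi / 2)"
  unfolding orbit_period_def
  using planar_solution_position_velocity[OF assms] has_minimal_period_planar_solution[OF assms]
    has_minimal_period_unique
  by (intro the_equality) blast+

text \<open>
  In the phase variable the quarter period is the integral over a fixed interval of a function that is jointly
  continuous in \<open>k\<close> and \<open>\<theta>\<close>.  In the variable \<open>s\<close> the integrand would be singular.
\<close>

lemma tendsto_orbit_period:
  assumes A: "A \<noteq> 0"
  shows "((\<lambda>k. orbit_period A k) \<longlongrightarrow> 4 * clock A 0 (pi / 2)) (at 0)"
proof -
  have clock: "clock A k (pi / 2) = integral (cbox 0 (pi / 2)) (slowness A k)" for k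
  proof -
    have "(slowness A k has_integral clock A k (pi / 2) - clock A k 0) {0..pi / 2}"
      by (intro fundamental_theorem_of_calculus)
        (auto intro: has_field_derivative_at_within DERIV_clock[OF A] simp flip: has_real_derivative_iff_has_vector_derivative)
    then show ?thesis using A by (simp add: clock_0 integral_unique)
  qed
  have "continuous_on UNIV (\<lambda>k. integral (cbox 0 (pi / 2)) (slowness A k))"
    by (intro integral_continuous_on_param)
      (auto simp: case_prod_beta intro!: continuous_on_slowness_param A continuous_intros)
  then have "continuous_on UNIV (\<lambda>k. 4 * clock A k (pi / 2))"
    unfolding clock by (intro continuous_intros)
  then have "((\<lambda>k. 4 * clock A k (pi / 2)) \<longlongrightarrow> 4 * clock A 0 (pi / 2)) (at 0)"
    by (simp add: continuous_on_eq_continuous_at isCont_def)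
  then show ?thesis
    by (rule Lim_transform_eventually)
      (auto simp: eventually_at orbit_period_eq_clock[OF A] intro!: exI[of _ 1])
qed

text \<open>
  This also holds at \<open>s = 0\<close>, where both totalised expressions are \<open>0\<close>.
\<close>

lemma period_integrand_0: "period_integrand A 0 s = limit_integrand s" if "A \<noteq> 0" "0 \<le> s"
  using that by (cases "s = 0") (auto simp: period_integrand_def limit_integrand_def ln_div ln_realpow)

lemma clock_0_quarter:
  assumes "A \<noteq> 0"
  shows "clock A 0 (pi / 2) = \<bar>A\<bar> * sqrt (pi / 2)"
proof -
  have "(limit_integrand has_integral clock A 0 (pi / 2) / \<bar>A\<bar>) {0..1}"
    using has_integral_period_integrand[OF assms, of 0]
    by (rule has_integral_eq[rotated]) (simp add: period_integrand_0 assms)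
  then have "clock A 0 (pi / 2) / \<bar>A\<bar> = sqrt (pi / 2)"
    using has_integral_limit_integrand has_integral_unique by blast
  then show ?thesis using assms by (simp add: field_simps)
qed

theorem theorem1p1:
  fixes A :: real
  assumes "A \<noteq> 0"
  shows
    "(\<exists>x. weak_C0_periodic_solution x \<and>
          x 0 = A \<and> (x has_real_derivative 0) (at 0) \<and>
          has_minimal_period x (2 * sqrt (2 * pi) * \<bar>A\<bar>)) \<and>
     (\<forall>k. k \<noteq> 0 \<longrightarrow>
          (\<exists>!\<gamma>. planar_solution k A \<gamma>) \<and>
          (\<forall>\<gamma>. planar_solution k A \<gamma> \<longrightarrow> has_minimal_period \<gamma> (orbit_period A k)) \<and>
          period_integrand A k integrable_on {0..1} \<and>
          orbit_period A k = 4 * \<bar>A\<bar> * integral {0..1} (period_integrand A k)) \<and>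
     limit_integrand integrable_on {0..1} \<and>
     ((\<lambda>k. orbit_period A k) \<longlongrightarrow> 4 * \<bar>A\<bar> * integral {0..1} limit_integrand) (at 0) \<and>
     4 * \<bar>A\<bar> * integral {0..1} limit_integrand = 2 * sqrt (2 * pi) * \<bar>A\<bar>"
proof -
  have "sqrt (2 * pi) = 2 * sqrt (pi / 2)"
    using real_sqrt_mult[of 4 "pi / 2"] by simp
  then have T0: "4 * clock A 0 (pi / 2) = 2 * sqrt (2 * pi) * \<bar>A\<bar>"
    "4 * \<bar>A\<bar> * integral {0..1} limit_integrand = 2 * sqrt (2 * pi) * \<bar>A\<bar>"
    using clock_0_quarter[OF assms] integral_unique[OF has_integral_limit_integrand] by simp_all
  show ?thesis
  proof (intro conjI allI impI)
    have "(position A 0 has_real_derivative 0) (at 0)"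
      using DERIV_position[OF assms, of 0 0] assms by (simp add: position_0 velocity_0)
    then show "\<exists>x. weak_C0_periodic_solution x \<and> x 0 = A \<and> (x has_real_derivative 0) (at 0) \<and>
        has_minimal_period x (2 * sqrt (2 * pi) * \<bar>A\<bar>)"
      using weak_C0_periodic_solution_position[OF assms] position_0[OF assms]
        has_minimal_period_position[OF assms, of 0] unfolding T0 by blast
    show "limit_integrand integrable_on {0..1}"
      using has_integral_limit_integrand by blast
    show "((\<lambda>k. orbit_period A k) \<longlongrightarrow> 4 * \<bar>A\<bar> * integral {0..1} limit_integrand) (at 0)"
      using tendsto_orbit_period[OF assms] unfolding T0 .
    show "4 * \<bar>A\<bar> * integral {0..1} limit_integrand = 2 * sqrt (2 * pi) * \<bar>A\<bar>"
      by (rule T0)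
    fix k :: real assume k: "k \<noteq> 0"
    show "\<exists>!\<gamma>. planar_solution k A \<gamma>"
      using planar_solution_position_velocity[OF assms k] planar_solution_unique[OF k] by blast
    show "has_minimal_period \<gamma> (orbit_period A k)" if "planar_solution k A \<gamma>" for \<gamma>
      using has_minimal_period_planar_solution[OF assms k that] orbit_period_eq_clock[OF assms k] by simp
    show "period_integrand A k integrable_on {0..1}"
      using has_integral_period_integrand[OF assms] by blast
    show "orbit_period A k = 4 * \<bar>A\<bar> * integral {0..1} (period_integrand A k)"
      using integral_unique[OF has_integral_period_integrand[OF assms, of k]]
        orbit_period_eq_clock[OF assms k] assms by simp
  qed
qed

end
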